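(* Let $p \ge 1$ and $n \ge 2p+2$ be integers. Then $$\Delta_2^t(C_n^p)\simeq \begin{cases} \mathbb{S}^{\frac{n-4}{2}} & \text{if } n=2p+2,\\ \mathbb{S}^{n-4} & \text{if } n\ge 3p+1. \end{cases}$$
   Context: All graphs are finite and simple. For a graph $G$, the total $2$-cut complex $\Delta_2^t(G)$ is the simplicial complex on vertex set $V(G)$ whose facets are the subsets $\sigma\subseteq V(G)$ with $|\sigma|=|V(G)|-2$ such that the induced subgraph $G[V(G)\setminus\sigma]$ has no edge; equivalently, $\sigma\subseteq V(G)$ is a face iff $V(G)\setminus\sigma$ contains two distinct non-adjacent vertices. For $n\ge 3$ and $p\ge1$, $C_n^p$ is the $p$-th power of the cycle graph $C_n$: it has vertex set $\{0,1,\dots,n-1\}$, and distinct $u,v$ are adjacent iff $v\equiv u\pm t \pmod n$ for some $1\le t\le p$. $\simeq$ denotes homotopy equivalence (of geometric realizations) and $\mathbb{S}^d$ the $d$-sphere. *)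

theory Defs
  imports "HOL-Analysis.Analysis" "HOL-Number_Theory.Cong" "Graph_Theory.Graph_Theory"
begin

text \<open>Finite simple graphs are the instances of the locale \<^locale>\<open>pair_graph\<close>: finite, loop-free,
  symmetric digraphs without parallel arcs.\<close>

definition cycle_power :: "nat \<Rightarrow> nat \<Rightarrow> nat pair_pre_digraph" where
  "cycle_power n p =
     \<lparr> pverts = {0..<n},
       parcs = {(u, v). u \<in> {0..<n} \<and> v \<in> {0..<n} \<and> u \<noteq> v \<and>
                 (\<exists>t\<in>{1..p}. [int v = int u + int t] (mod int n) \<or>
                            [int v = int u - int t] (mod int n))} \<rparr>"

lemma pair_graph_cycle_power: "pair_graph (cycle_power n p)"
proof
  show "finite (parcs (cycle_power n p))"
    by (rule finite_subset[of _ "{0..<n} \<times> {0..<n}"]) (auto simp: cycle_power_def)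
  have sw: "[int u = int v - int t] (mod int n)" if "[int v = int u + int t] (mod int n)" for u v t
    using cong_diff[OF that cong_refl[of "int t"]] by (simp add: cong_sym)
  have sw': "[int u = int v + int t] (mod int n)" if "[int v = int u - int t] (mod int n)" for u v t
    using cong_add[OF that cong_refl[of "int t"]] by (simp add: cong_sym)
  show "symmetric (with_proj (cycle_power n p))"
    unfolding symmetric_def with_proj_simps
    by (rule symI) (auto simp: cycle_power_def dest: sw sw')
qed (auto simp: cycle_power_def)

definition total_2_cut_facets :: "'a pair_pre_digraph \<Rightarrow> 'a set set" where
  "total_2_cut_facets G =
     {\<sigma>. \<sigma> \<subseteq> pverts G \<and> card \<sigma> + 2 = card (pverts G) \<and>
         arcs (induce_subgraph (with_proj G) (pverts G - \<sigma>)) = {}}"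

definition total_2_cut_complex :: "'a pair_pre_digraph \<Rightarrow> 'a set set" where
  "total_2_cut_complex G = {\<tau>. \<exists>\<sigma>\<in>total_2_cut_facets G. \<tau> \<subseteq> \<sigma>}"

lemma (in pair_graph) total_2_cut_complex_iff:
  "\<tau> \<in> total_2_cut_complex G \<longleftrightarrow>
     \<tau> \<subseteq> pverts G \<and> (\<exists>u v. u \<in> pverts G - \<tau> \<and> v \<in> pverts G - \<tau> \<and> u \<noteq> v \<and> (u, v) \<notin> parcs G)"
proof
  assume "\<tau> \<in> total_2_cut_complex G"
  then obtain \<sigma> where s: "\<tau> \<subseteq> \<sigma>" "\<sigma> \<subseteq> pverts G" "card \<sigma> + 2 = card (pverts G)"
    "arcs (induce_subgraph (with_proj G) (pverts G - \<sigma>)) = {}"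
    by (auto simp: total_2_cut_complex_def total_2_cut_facets_def)
  have "card (pverts G - \<sigma>) = 2"
    using s pair_finite_verts by (simp add: card_Diff_subset finite_subset)
  then obtain u v where uv: "pverts G - \<sigma> = {u, v}" "u \<noteq> v"
    by (auto simp: card_2_iff)
  have "(u, v) \<notin> parcs G"
    using s(4) uv(1) by auto
  with s(1,2) uv show "\<tau> \<subseteq> pverts G \<and> (\<exists>u v. u \<in> pverts G - \<tau> \<and> v \<in> pverts G - \<tau> \<and> u \<noteq> v \<and> (u, v) \<notin> parcs G)"
    by blast
next
  assume "\<tau> \<subseteq> pverts G \<and> (\<exists>u v. u \<in> pverts G - \<tau> \<and> v \<in> pverts G - \<tau> \<and> u \<noteq> v \<and> (u, v) \<notin> parcs G)"
  then obtain u v where uv: "\<tau> \<subseteq> pverts G" "u \<in> pverts G - \<tau>" "v \<in> pverts G - \<tau>" "u \<noteq> v"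
    "(u, v) \<notin> parcs G" by blast
  have vu: "(v, u) \<notin> parcs G"
    using pair_sym_arcs uv(5) by (auto simp: symmetric_def dest: symD)
  have "card (pverts G - {u, v}) + 2 = card (pverts G)"
  proof -
    have "card {u, v} \<le> card (pverts G)"
      using uv pair_finite_verts by (intro card_mono) auto
    then show ?thesis
      using uv by (simp add: card_Diff_subset)
  qed
  moreover have "arcs (induce_subgraph (with_proj G) (pverts G - (pverts G - {u, v}))) = {}"
    using uv vu pair_no_loops by fastforce
  ultimately have "pverts G - {u, v} \<in> total_2_cut_facets G"
    by (auto simp: total_2_cut_facets_def)
  moreover have "\<tau> \<subseteq> pverts G - {u, v}" using uv by blast
  ultimately show "\<tau> \<in> total_2_cut_complex G"
    unfolding total_2_cut_complex_def by blast
qed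

text \<open>Points of the realization of a finite abstract simplicial complex \<open>K\<close> are given by their
  barycentric coordinates, extended by zero outside the vertex set of \<open>K\<close>. The subspace topology
  of the product topology is the usual one because \<open>K\<close> is finite (for infinite complexes it would
  in general be coarser than the weak topology).\<close>

definition geometric_realization :: "'a set set \<Rightarrow> ('a \<Rightarrow> real) topology" where
  "geometric_realization K =
     subtopology (powertop_real UNIV)
       {x. (\<forall>v. 0 \<le> x v) \<and> {v. x v \<noteq> 0} \<in> K \<and> (\<Sum>v | x v \<noteq> 0. x v) = 1}"

end

theory Submission
  imports Defs
begin

text \<open>
  If the link of a face \<open>L\<close> is a cone with apex \<open>w\<close>, then the open star of \<open>L\<close> can be deleted: moving
  the smallest barycentric coordinate on \<open>L\<close> from every vertex of \<open>L\<close> to \<open>w\<close> is a deformation retraction.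
  All homotopy equivalences here are chains of such deletions, ending at the boundary of a simplex.

  The complex is Alexander dual to the clique complex. In \<open>C\<^sub>n\<^sup>p\<close> with \<open>n \<ge> 3p + 1\<close>, the common neighbours of
  \<open>k\<close> and \<open>k + p\<close> are \<open>k + 1, \<dots>, k + p - 1\<close>, so for \<open>p \<ge> 2\<close> the edge \<open>{k, k + p}\<close> has a full simplex as link
  in the clique complex, and deleting it is dual to the deletion of a star. This reduces the claim to
  \<open>p = 1\<close>, where the faces \<open>{m + 1, \<dots>, n - 2}\<close> for \<open>m = 1, \<dots>, n - 3\<close>, and then \<open>{n - 1}\<close>, are deleted with apexes
  \<open>m - 1\<close> and \<open>n - 3\<close>; the proper subsets of \<open>{0, \<dots>, n - 3}\<close> remain.

  For \<open>n = 2p + 2\<close> the non-edges are the antipodal pairs. Deleting each vertex \<open>i + p + 1\<close> with apex \<open>i\<close> leaves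
  the proper subsets of \<open>{0, \<dots>, p}\<close>.
\<close>

section \<open>Realizations as subspaces, and deletion of the open star of a face\<close>

definition realization_points :: "'a set set \<Rightarrow> ('a \<Rightarrow> real) set" where
  "realization_points K = {x. (\<forall>v. 0 \<le> x v) \<and> {v. x v \<noteq> 0} \<in> K \<and> (\<Sum>v | x v \<noteq> 0. x v) = 1}"

text \<open>The real product topology over \<open>UNIV\<close> is the Euclidean topology on
  functions, so continuity can be handled by \<open>continuous_on\<close> and checked
  coordinatewise.\<close>

lemma geometric_realization_top_of_set:
  "geometric_realization K = top_of_set (realization_points K)"
  by (simp add: geometric_realization_def realization_points_def euclidean_product_topology)

lemma sum_support_eq:
  fixes x :: "'a \<Rightarrow> real"
  assumes "finite F" "{v. x v \<noteq> 0} \<subseteq> F"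
  shows "(\<Sum>v | x v \<noteq> 0. x v) = sum x F"
  using assms by (intro sum.mono_neutral_left) auto

lemma continuous_on_Min_image:
  fixes f :: "'i \<Rightarrow> 'b::topological_space \<Rightarrow> real"
  assumes "finite I" "I \<noteq> {}" "\<And>i. i \<in> I \<Longrightarrow> continuous_on S (f i)"
  shows "continuous_on S (\<lambda>x. Min ((\<lambda>i. f i x) ` I))"
  using assms
proof (induction I rule: finite_ne_induct)
  case (insert i I)
  have "continuous_on S (\<lambda>x. min (f i x) (Min ((\<lambda>i. f i x) ` I)))"
    using insert by (intro continuous_on_min) auto
  then show ?case using insert by simp
qed simp

lemma homotopy_equivalent_space_delete_cone_star:
  fixes K :: "'a set set"
  assumes fin: "\<And>\<sigma>. \<sigma> \<in> K \<Longrightarrow> finite \<sigma>"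
    and down: "\<And>\<sigma> \<tau>. \<sigma> \<in> K \<Longrightarrow> \<tau> \<subseteq> \<sigma> \<Longrightarrow> \<tau> \<in> K"
    and L: "finite L" "L \<noteq> {}" "w \<notin> L"
    and cone: "\<And>\<sigma>. \<sigma> \<in> K \<Longrightarrow> L \<subseteq> \<sigma> \<Longrightarrow> insert w \<sigma> \<in> K"
  shows "geometric_realization K homotopy_equivalent_space
         geometric_realization {\<sigma> \<in> K. \<not> L \<subseteq> \<sigma>}"
proof -
  define A where "A = realization_points K"
  define B where "B = realization_points {\<sigma> \<in> K. \<not> L \<subseteq> \<sigma>}"
  define t where "t x = Min ((\<lambda>v. x v) ` L)" for x :: "'a \<Rightarrow> real"
  \<comment> \<open>Direction of the flow: each vertex of \<open>L\<close> loses one unit and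
    \<open>w\<close> gains \<open>card L\<close>, so total mass is preserved. Multiplied by
    \<open>t x\<close>, the smallest coordinate on \<open>L\<close>, it empties a minimising vertex
    exactly at time 1.\<close>
  define c where "c v = (if v = w then real (card L) else if v \<in> L then - 1 else 0)" for v
  define h where "h s x v = x v + s * t x * c v" for s x v
  have BA: "B \<subseteq> A"
    by (auto simp: A_def B_def realization_points_def)
  have t_le: "t x \<le> x v" if "v \<in> L" for x v
    using that L(1) by (simp add: t_def)
  have t_att: "\<exists>v\<in>L. t x = x v" for x
  proof -
    have "Min ((\<lambda>v. x v) ` L) \<in> (\<lambda>v. x v) ` L" using L by (intro Min_in) auto
    then show ?thesis unfolding t_def by auto
  qed
  have t_nonneg: "0 \<le> t x" if "x \<in> A" for x
    using t_att[of x] that by (auto simp: A_def realization_points_def)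
  \<comment> \<open>A support that omits a vertex of \<open>L\<close> has minimum 0 on
    \<open>L\<close>, so the flow fixes \<open>B\<close> pointwise.\<close>
  have t_B: "t x = 0" if "x \<in> B" for x
  proof -
    have "\<not> L \<subseteq> {v. x v \<noteq> 0}" using that by (simp add: B_def realization_points_def)
    then obtain v where "v \<in> L" "x v = 0" by blast
    then show ?thesis using t_le[of v x] t_nonneg[of x] BA that by auto
  qed
  have h_A: "h s x \<in> A" if x: "x \<in> A" and s: "0 \<le> s" "s \<le> 1" for s x
  proof (cases "t x = 0")
    case True
    then have "h s x = x" by (simp add: h_def fun_eq_iff)
    with x show ?thesis by simp
  next
    case False
    with t_nonneg[OF x] have tp: "0 < t x" by simp
    \<comment> \<open>A positive minimum puts \<open>L\<close> inside the support of
      \<open>x\<close>, so \<open>cone\<close> makes this enlarged support a face. It contains the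
      support of \<open>h s x\<close>.\<close>
    let ?F = "insert w {v. x v \<noteq> 0}"
    have x': "\<And>v. 0 \<le> x v" "{v. x v \<noteq> 0} \<in> K" "(\<Sum>v | x v \<noteq> 0. x v) = 1"
      using x by (auto simp: A_def realization_points_def)
    have LF: "L \<subseteq> {v. x v \<noteq> 0}" using t_le[of _ x] tp by force
    have FK: "?F \<in> K" using cone[OF x'(2) LF] .
    have Ffin: "finite ?F" using fin[OF FK] .
    have st: "s * t x \<le> t x" using s tp by (simp add: mult_left_le_one_le)
    have "0 \<le> h s x v" for v
    proof (cases "v \<in> L")
      case True
      then show ?thesis using L(3) t_le[OF True, of x] st by (auto simp: h_def c_def)
    next
      case False
      then show ?thesis using x'(1)[of v] s tp by (auto simp: h_def c_def)
    qed
    moreover have sub: "{v. h s x v \<noteq> 0} \<subseteq> ?F"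
      using LF by (auto simp: h_def c_def split: if_splits)
    moreover have "sum c ?F = 0"
    proof -
      have "sum c ?F = sum c (insert w L)"
        using LF Ffin by (intro sum.mono_neutral_right) (auto simp: c_def)
      also have "\<dots> = real (card L) + sum c L" using L by (simp add: c_def)
      also have "sum c L = (\<Sum>v\<in>L. - 1)" using L(3) by (intro sum.cong) (auto simp: c_def)
      finally show ?thesis by simp
    qed
    then have "sum (h s x) ?F = sum x ?F"
      by (simp add: h_def sum.distrib flip: sum_distrib_left)
    moreover have "sum x ?F = 1" using x'(3) sum_support_eq[OF Ffin, of x] by auto
    ultimately show ?thesis
      using down[OF FK sub] sum_support_eq[OF Ffin sub] by (auto simp: A_def realization_points_def)
  qed
  have h_B: "h 1 x \<in> B" if x: "x \<in> A" for x
  proof -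
    obtain v where v: "v \<in> L" "t x = x v" using t_att by blast
    then have "h 1 x v = 0" using L(3) by (auto simp: h_def c_def)
    with v(1) h_A[OF x, of 1] show ?thesis by (auto simp: A_def B_def realization_points_def)
  qed
  have coord: "continuous_on S (\<lambda>z. snd z v)" for S :: "(real \<times> ('a \<Rightarrow> real)) set" and v
    by (rule continuous_on_product_then_coordinatewise[OF continuous_on_snd[OF continuous_on_id]])
  have cont: "continuous_on S (\<lambda>z. h (fst z) (snd z))" for S
    unfolding h_def t_def using L(1,2)
    by (intro continuous_on_coordinatewise_then_product continuous_intros continuous_on_Min_image coord)
  have cont1: "continuous_on A (h 1)"
  proof -
    have "continuous_on A ((\<lambda>z. h (fst z) (snd z)) \<circ> (\<lambda>x. (1, x)))"
      by (intro continuous_on_compose continuous_intros cont)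
    then show ?thesis by (simp add: o_def)
  qed
  have "homotopic_with (\<lambda>x. True) (top_of_set A) (top_of_set A) id (h 1)"
    unfolding homotopic_with_def
  proof (intro exI conjI ballI allI)
    show "continuous_map (prod_topology (top_of_set {0..1}) (top_of_set A)) (top_of_set A)
            (\<lambda>z. h (fst z) (snd z))"
      using cont h_A by auto
  qed (auto simp: h_def fun_eq_iff)
  then have "homotopic_with (\<lambda>x. True) (top_of_set A) (top_of_set A) (h 1) id"
    by (rule homotopic_with_symD)
  moreover have "retraction_maps (top_of_set A) (top_of_set B) (h 1) id"
    unfolding retraction_maps_def using cont1 h_B BA t_B
    by (auto simp: h_def fun_eq_iff)
  ultimately show ?thesis
    unfolding geometric_realization_top_of_set A_def[symmetric] B_def[symmetric]
    by (rule deformation_retract_imp_homotopy_equivalent_space)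
qed

section \<open>The boundary of a simplex is a sphere\<close>

lemma nsphere_top_of_set: "nsphere d = top_of_set {x. (\<Sum>i\<le>d. x i ^ 2) = 1 \<and> (\<forall>i>d. x i = 0)}"
  by (simp add: nsphere euclidean_product_topology)

lemma Min_image_affine:
  fixes x :: "'a \<Rightarrow> real"
  assumes "finite I" "I \<noteq> {}" "0 < r"
  shows "Min ((\<lambda>i. (x i - c) / r) ` I) = (Min (x ` I) - c) / r"
proof (rule Min_eqI)
  have "Min (x ` I) \<in> x ` I" using assms by simp
  then show "(Min (x ` I) - c) / r \<in> (\<lambda>i. (x i - c) / r) ` I" by auto
qed (use assms in \<open>auto simp: divide_right_mono\<close>)

text \<open>Subtract the last coordinate and normalise; the inverse subtracts the minimum and rescales to
  total mass one.\<close>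

lemma boundary_simplex_homeomorphic_nsphere:
  "geometric_realization {\<sigma>. \<sigma> \<subset> {..Suc d}} homeomorphic_space nsphere d"
proof -
  define A where "A = realization_points {\<sigma>. \<sigma> \<subset> {..Suc d}}"
  define B where "B = {x::nat \<Rightarrow> real. (\<Sum>i\<le>d. x i ^ 2) = 1 \<and> (\<forall>i>d. x i = 0)}"
  define N where "N x = sqrt (\<Sum>j\<le>d. (x j - x (Suc d))\<^sup>2)" for x :: "nat \<Rightarrow> real"
  define f where "f x i = (if i \<le> Suc d then (x i - x (Suc d)) / N x else 0)" for x :: "nat \<Rightarrow> real" and i
  define m where "m y = Min ((\<lambda>i. y i) ` {..Suc d})" for y :: "nat \<Rightarrow> real"
  define T where "T y = (\<Sum>j\<le>Suc d. y j - m y)" for y :: "nat \<Rightarrow> real"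
  define g where "g y i = (if i \<le> Suc d then (y i - m y) / T y else 0)" for y :: "nat \<Rightarrow> real" and i
  have m_le: "m y \<le> y i" if "i \<le> Suc d" for y i using that by (simp add: m_def)
  have m_att: "\<exists>i\<le>Suc d. m y = y i" for y
  proof -
    have "Min ((\<lambda>i. y i) ` {..Suc d}) \<in> (\<lambda>i. y i) ` {..Suc d}" by (intro Min_in) auto
    then show ?thesis unfolding m_def by blast
  qed
  \<comment> \<open>Properness of the support says that some coordinate up to \<open>Suc d\<close>
    vanishes; as no coordinate is negative, this is \<open>m x = 0\<close>.\<close>
  have A_iff: "x \<in> A \<longleftrightarrow> (\<forall>v. 0 \<le> x v) \<and> (\<forall>v>Suc d. x v = 0) \<and> m x = 0 \<and> (\<Sum>v\<le>Suc d. x v) = 1" for x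
  proof -
    have *: "{v. x v \<noteq> 0} \<subseteq> {..Suc d} \<longleftrightarrow> (\<forall>v>Suc d. x v = 0)"
      unfolding subset_iff mem_Collect_eq atMost_iff not_less[symmetric] by blast
    have "m x = 0 \<longleftrightarrow> (\<exists>i\<le>Suc d. x i = 0)" if "\<forall>v. 0 \<le> x v"
      using that m_att[of x] m_le[of _ x] by (metis order_antisym)
    then show ?thesis
      using sum_support_eq[of "{..Suc d}" x] *
      by (auto simp: A_def realization_points_def psubset_eq)
  qed
  \<comment> \<open>If \<open>N x\<close> were 0, all coordinates up to \<open>Suc d\<close> would
    agree with the vanishing one, against total mass one.\<close>
  have N_pos: "0 < N x" if x: "x \<in> A" for x
  proof (rule ccontr)
    assume "\<not> 0 < N x"
    moreover have "0 \<le> N x" by (simp add: N_def sum_nonneg)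
    ultimately have "N x = 0" by simp
    then have "(\<Sum>j\<le>d. (x j - x (Suc d))\<^sup>2) = 0" by (simp add: N_def)
    then have "\<forall>j\<le>d. x j = x (Suc d)" by (simp add: sum_nonneg_eq_0_iff)
    then have eq: "x j = x (Suc d)" if "j \<le> Suc d" for j using that by (auto simp: le_Suc_eq)
    obtain i where "i \<le> Suc d" "x i = 0" using x m_att[of x] by (auto simp: A_iff)
    then have "x j = 0" if "j \<le> Suc d" for j using eq that by metis
    then show False using x by (auto simp: A_iff)
  qed
  \<comment> \<open>If \<open>T y\<close> were 0, then \<open>y\<close> would be constant on
    \<open>{..Suc d}\<close>, with value \<open>y (Suc d) = 0\<close>, against norm one.\<close>
  have T_pos: "0 < T y" if y: "y \<in> B" for y
  proof -
    have ge: "0 \<le> T y" unfolding T_def using m_le by (intro sum_nonneg) auto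
    have "T y \<noteq> 0"
    proof
      assume "T y = 0"
      then have "\<forall>j\<in>{..Suc d}. y j - m y = 0" unfolding T_def
        using m_le by (subst (asm) sum_nonneg_eq_0_iff) auto
      then have eq: "y j = m y" if "j \<le> Suc d" for j using that by force
      have y0: "y (Suc d) = 0" and y1: "(\<Sum>i\<le>d. (y i)\<^sup>2) = 1" using y unfolding B_def by blast+
      have "y j = 0" if "j \<le> d" for j using eq[of j] eq[of "Suc d"] y0 that by linarith
      then have "(\<Sum>i\<le>d. (y i)\<^sup>2) = 0" by simp
      then show False using y1 by linarith
    qed
    with ge show ?thesis by simp
  qed
  have fB: "f x \<in> B" if x: "x \<in> A" for x
  proof -
    have "(\<Sum>i\<le>d. (f x i)\<^sup>2) = (\<Sum>i\<le>d. (x i - x (Suc d))\<^sup>2) / (N x)\<^sup>2"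
      by (simp add: f_def power_divide sum_divide_distrib)
    also have "(\<Sum>i\<le>d. (x i - x (Suc d))\<^sup>2) = (N x)\<^sup>2" by (simp add: N_def sum_nonneg)
    finally show ?thesis using N_pos[OF x] by (auto simp: B_def f_def le_Suc_eq)
  qed
  have m_g: "m (g y) = (m y - m y) / T y" if "y \<in> B" for y
  proof -
    have "m (g y) = Min ((\<lambda>i. (y i - m y) / T y) ` {..Suc d})"
      unfolding m_def[of "g y"] by (intro arg_cong[where f = Min] image_cong) (auto simp: g_def)
    also have "\<dots> = (m y - m y) / T y"
      using Min_image_affine[of "{..Suc d}" "T y" "\<lambda>i. y i" "m y"] T_pos[OF that] by (simp add: m_def)
    finally show ?thesis .
  qed
  have m_f: "m (f x) = (m x - x (Suc d)) / N x" if "x \<in> A" for x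
  proof -
    have "m (f x) = Min ((\<lambda>i. (x i - x (Suc d)) / N x) ` {..Suc d})"
      unfolding m_def[of "f x"] by (intro arg_cong[where f = Min] image_cong) (auto simp: f_def)
    also have "\<dots> = (m x - x (Suc d)) / N x"
      using Min_image_affine[of "{..Suc d}" "N x" "\<lambda>i. x i" "x (Suc d)"] N_pos[OF that] by (simp add: m_def)
    finally show ?thesis .
  qed
  have gA: "g y \<in> A" if y: "y \<in> B" for y
  proof -
    have "(\<Sum>v\<le>Suc d. g y v) = (\<Sum>v\<le>Suc d. y v - m y) / T y"
      unfolding sum_divide_distrib by (intro sum.cong) (auto simp: g_def)
    also have "\<dots> = 1" using T_pos[OF y] by (simp add: T_def)
    finally show ?thesis using m_g[OF y] m_le T_pos[OF y] by (auto simp: A_iff g_def)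
  qed
  have gf: "g (f x) = x" if x: "x \<in> A" for x
  proof -
    have mx: "m x = 0" and sx: "(\<Sum>v\<le>Suc d. x v) = 1" using x unfolding A_iff by blast+
    \<comment> \<open>\<open>f\<close> translates and rescales. Subtracting the minimum undoes the
      translation because \<open>m x = 0\<close>, and normalising the mass then undoes the
      scaling.\<close>
    have d: "f x i - m (f x) = x i / N x" if "i \<le> Suc d" for i
      using that m_f[OF x] mx by (simp add: f_def diff_divide_distrib)
    have "T (f x) = (\<Sum>v\<le>Suc d. x v / N x)" unfolding T_def using d by (intro sum.cong) auto
    also have "\<dots> = 1 / N x" using sx by (simp only: flip: sum_divide_distrib)
    finally have "T (f x) = 1 / N x" .
    then show ?thesis using x d N_pos[OF x] by (auto simp: g_def fun_eq_iff A_iff)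
  qed
  have fg: "f (g y) = y" if y: "y \<in> B" for y
  proof -
    have ys: "y (Suc d) = 0" "(\<Sum>i\<le>d. (y i)\<^sup>2) = 1" using y by (auto simp: B_def)
    \<comment> \<open>The shift by \<open>m y\<close> cancels in the difference, and
      \<open>y (Suc d) = 0\<close>.\<close>
    have d: "g y i - g y (Suc d) = y i / T y" if "i \<le> Suc d" for i
      using that ys by (simp add: g_def diff_divide_distrib)
    have "N (g y) = sqrt (\<Sum>j\<le>d. (y j / T y)\<^sup>2)" unfolding N_def using d by simp
    also have "\<dots> = 1 / T y"
      using ys T_pos[OF y] by (simp add: power_divide real_sqrt_divide flip: sum_divide_distrib)
    finally have "N (g y) = 1 / T y" .
    then show ?thesis using y d T_pos[OF y] by (auto simp: f_def fun_eq_iff B_def)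
  qed
  have coord: "continuous_on S (\<lambda>z. z v)" for S :: "(nat \<Rightarrow> real) set" and v
    by (rule continuous_on_product_then_coordinatewise[OF continuous_on_id])
  have "continuous_on A (\<lambda>x. f x i)" for i
  proof (cases "i \<le> Suc d")
    case True
    have "continuous_on A (\<lambda>x. (x i - x (Suc d)) / N x)"
      using N_pos unfolding N_def by (intro continuous_intros coord) fastforce
    then show ?thesis using True by (simp add: f_def)
  qed (simp add: f_def)
  then have cf: "continuous_on A f" by (rule continuous_on_coordinatewise_then_product)
  have cm: "continuous_on B m"
    unfolding m_def by (intro continuous_on_Min_image coord) auto
  have "continuous_on B (\<lambda>y. g y i)" for i
  proof (cases "i \<le> Suc d")
    case True
    have "continuous_on B (\<lambda>y. (y i - m y) / T y)"
      using T_pos unfolding T_def by (intro continuous_intros coord cm) fastforce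
    then show ?thesis using True by (simp add: g_def)
  qed (simp add: g_def)
  then have cg: "continuous_on B g" by (rule continuous_on_coordinatewise_then_product)
  have "homeomorphic_maps (top_of_set A) (top_of_set B) f g"
    unfolding homeomorphic_maps_def using cf cg fB gA gf fg by auto
  then show ?thesis
    unfolding geometric_realization_top_of_set nsphere_top_of_set A_def[symmetric] B_def[symmetric]
    by (rule homeomorphic_maps_imp_homeomorphic_space)
qed

section \<open>Alexander duals of clique complexes, and removal of an edge\<close>

definition nonclique_complex :: "'a set \<Rightarrow> ('a \<Rightarrow> 'a \<Rightarrow> bool) \<Rightarrow> 'a set set" where
  "nonclique_complex V E = {\<sigma>. \<sigma> \<subseteq> V \<and> (\<exists>u\<in>V - \<sigma>. \<exists>v\<in>V - \<sigma>. u \<noteq> v \<and> \<not> E u v)}"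

text \<open>By \<open>clique\<close> and \<open>common\<close>, the cliques through \<open>a\<close>
  and \<open>b\<close> are exactly the subsets of \<open>S\<close> containing both. Hence removing
  the edge adds exactly the faces between \<open>V - S\<close> and \<open>V - {a, b}\<close>. They
  form the open star of \<open>V - S\<close> in the larger complex, and any \<open>w\<close> in
  \<open>S\<close> other than \<open>a\<close> and \<open>b\<close> is an apex for it.\<close>

lemma nonclique_complex_delete_edge:
  assumes V: "finite V" and ab: "a \<in> V" "b \<in> V" "a \<noteq> b"
    and sym: "\<And>u v. E u v \<Longrightarrow> E v u"
    and w: "w \<in> S" "w \<noteq> a" "w \<noteq> b"
    and S: "S \<subset> V" "a \<in> S" "b \<in> S"
    and clique: "\<And>u v. u \<in> S \<Longrightarrow> v \<in> S \<Longrightarrow> u \<noteq> v \<Longrightarrow> E u v"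
    and common: "\<And>c. c \<in> V \<Longrightarrow> E a c \<Longrightarrow> E b c \<Longrightarrow> c \<in> S"
  shows "geometric_realization (nonclique_complex V (\<lambda>u v. E u v \<and> {u, v} \<noteq> {a, b}))
           homotopy_equivalent_space geometric_realization (nonclique_complex V E)"
proof -
  let ?K = "nonclique_complex V (\<lambda>u v. E u v \<and> {u, v} \<noteq> {a, b})"
  let ?L = "V - S"
  have "geometric_realization ?K homotopy_equivalent_space
        geometric_realization {\<sigma> \<in> ?K. \<not> ?L \<subseteq> \<sigma>}"
  proof (rule homotopy_equivalent_space_delete_cone_star)
    show "finite \<sigma>" if "\<sigma> \<in> ?K" for \<sigma>
      using that V by (auto simp: nonclique_complex_def intro: finite_subset)
    show "\<tau> \<in> ?K" if "\<sigma> \<in> ?K" "\<tau> \<subseteq> \<sigma>" for \<sigma> \<tau>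
      using that unfolding nonclique_complex_def by blast
    show "finite ?L" "?L \<noteq> {}" "w \<notin> ?L" using V S w by auto
    show "insert w \<sigma> \<in> ?K" if s: "\<sigma> \<in> ?K" "?L \<subseteq> \<sigma>" for \<sigma>
    proof -
      obtain u v where uv: "u \<in> V - \<sigma>" "v \<in> V - \<sigma>" "u \<noteq> v" "\<not> (E u v \<and> {u, v} \<noteq> {a, b})"
        and sV: "\<sigma> \<subseteq> V"
        using s(1) unfolding nonclique_complex_def by blast
      \<comment> \<open>Inside \<open>S\<close> the removed edge is the only non-adjacent pair, so
        it is the witness; it survives the insertion of \<open>w\<close>.\<close>
      have "u \<in> S" "v \<in> S" using uv s(2) by auto
      then have "{u, v} = {a, b}" using clique uv by blast
      moreover have "{u, v} \<subseteq> V - \<sigma>" using uv by blast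
      ultimately have "a \<notin> \<sigma>" "b \<notin> \<sigma>" by auto
      then show ?thesis
        using ab w S sV unfolding nonclique_complex_def by blast
    qed
  qed
  moreover have "{\<sigma> \<in> ?K. \<not> ?L \<subseteq> \<sigma>} = nonclique_complex V E"
  proof (intro equalityI subsetI)
    fix \<sigma> assume "\<sigma> \<in> {\<sigma> \<in> ?K. \<not> ?L \<subseteq> \<sigma>}"
    then obtain u v l where *: "\<sigma> \<subseteq> V" "u \<in> V - \<sigma>" "v \<in> V - \<sigma>" "u \<noteq> v"
      "\<not> (E u v \<and> {u, v} \<noteq> {a, b})" and l: "l \<in> V" "l \<notin> S" "l \<notin> \<sigma>"
      unfolding nonclique_complex_def by blast
    show "\<sigma> \<in> nonclique_complex V E"
    proof (cases "E u v")
      case True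
      then have "{u, v} = {a, b}" using * by blast
      moreover have "{u, v} \<subseteq> V - \<sigma>" using * by blast
      ultimately have "a \<notin> \<sigma>" "b \<notin> \<sigma>" by auto
      \<comment> \<open>The vertex \<open>l\<close> outside \<open>S\<close> is not a common
        neighbour, so \<open>{a, l}\<close> or \<open>{b, l}\<close> replaces the witness
        \<open>{a, b}\<close>.\<close>
      moreover have "\<not> E a l \<or> \<not> E b l" "a \<noteq> l" "b \<noteq> l" using common l S by blast+
      ultimately show ?thesis using ab l *(1) unfolding nonclique_complex_def by blast
    next
      case False
      then show ?thesis using * unfolding nonclique_complex_def by blast
    qed
  next
    fix \<sigma> assume "\<sigma> \<in> nonclique_complex V E"
    then obtain u v where *: "\<sigma> \<subseteq> V" "u \<in> V - \<sigma>" "v \<in> V - \<sigma>" "u \<noteq> v" "\<not> E u v"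
      unfolding nonclique_complex_def by blast
    then have "u \<notin> S \<or> v \<notin> S" using clique by blast
    then show "\<sigma> \<in> {\<sigma> \<in> ?K. \<not> ?L \<subseteq> \<sigma>}"
      using * unfolding nonclique_complex_def by blast
  qed
  ultimately show ?thesis by simp
qed

section \<open>Forward distance on the cycle, and reduction to the first power\<close>

definition cyc_dist :: "nat \<Rightarrow> nat \<Rightarrow> nat \<Rightarrow> int" where
  "cyc_dist n u v = (int v - int u) mod int n"

definition cyc_adj :: "nat \<Rightarrow> nat \<Rightarrow> nat \<Rightarrow> nat \<Rightarrow> bool" where
  "cyc_adj n q u v \<longleftrightarrow> cyc_dist n u v \<in> {1..int q} \<or> cyc_dist n v u \<in> {1..int q}"

text \<open>The edges \<open>{i, i + q}\<close> of \<open>C\<^sub>n\<^sup>q\<close> with \<open>i < k\<close> are removed, so that \<open>k\<close> interpolates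
  between \<open>C\<^sub>n\<^sup>q\<close> at \<open>k = 0\<close> and the power \<open>q - 1\<close> at \<open>k = n\<close>.\<close>

definition cyc_adj_from :: "nat \<Rightarrow> nat \<Rightarrow> nat \<Rightarrow> nat \<Rightarrow> nat \<Rightarrow> bool" where
  "cyc_adj_from n q k u v \<longleftrightarrow> cyc_adj n (q - 1) u v \<or>
     (cyc_dist n u v = int q \<and> k \<le> u) \<or> (cyc_dist n v u = int q \<and> k \<le> v)"

lemma cyc_adj_from_sym: "cyc_adj_from n q k u v \<Longrightarrow> cyc_adj_from n q k v u"
  by (auto simp: cyc_adj_from_def cyc_adj_def)

lemma cyc_dist_range: "0 < n \<Longrightarrow> 0 \<le> cyc_dist n u v \<and> cyc_dist n u v < int n"
  by (simp add: cyc_dist_def)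

text \<open>Change of base point: both vertices are located by their distance from \<open>k\<close>.
  This trades modular arithmetic for linear arithmetic with one case split, which the adjacency
  arguments below rely on.\<close>

lemma cyc_dist_relative:
  assumes "0 < n"
  shows "cyc_dist n u v = (if cyc_dist n k u \<le> cyc_dist n k v then cyc_dist n k v - cyc_dist n k u
           else cyc_dist n k v - cyc_dist n k u + int n)"
proof -
  let ?d = "cyc_dist n k v - cyc_dist n k u"
  have eq: "cyc_dist n u v = ?d mod int n"
    by (simp add: cyc_dist_def mod_diff_eq)
  have r: "0 \<le> cyc_dist n k v" "cyc_dist n k v < int n" "0 \<le> cyc_dist n k u" "cyc_dist n k u < int n"
    using cyc_dist_range[OF assms] by auto
  show ?thesis
  proof (cases "cyc_dist n k u \<le> cyc_dist n k v")
    case True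
    then show ?thesis unfolding eq using r by simp
  next
    case False
    have "?d mod int n = (?d + int n) mod int n" by simp
    also have "\<dots> = ?d + int n" using False r by (intro mod_pos_pos_trivial) auto
    finally show ?thesis unfolding eq using False by simp
  qed
qed

lemma cyc_dist_eq_iff:
  assumes "u < n" "v < n"
  shows "cyc_dist n k u = cyc_dist n k v \<longleftrightarrow> u = v"
proof
  assume "cyc_dist n k u = cyc_dist n k v"
  then have "int u mod int n = int v mod int n"
    by (simp add: cyc_dist_def mod_eq_dvd_iff)
  then show "u = v" using assms by (simp flip: of_nat_mod)
qed simp

lemma ex_cyc_dist:
  assumes "s < n"
  shows "\<exists>v<n. cyc_dist n k v = int s"
proof (intro exI conjI)
  show "(k + s) mod n < n" using assms by simp
  show "cyc_dist n k ((k + s) mod n) = int s"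
    using assms by (simp add: cyc_dist_def zmod_int mod_diff_left_eq)
qed

text \<open>The edge removed joins \<open>k\<close> to \<open>b\<close>, which lies \<open>q\<close>
  steps further on. The clique \<open>?S\<close> is the arc from \<open>k\<close> to
  \<open>b\<close>, and the apex \<open>w\<close> is the successor of \<open>k\<close>, strictly
  inside the arc because \<open>q \<ge> 2\<close>. The other way from \<open>b\<close> back to
  \<open>k\<close> has length \<open>n - q \<ge> 2 * q + 1\<close>, too long for two edges, so all
  common neighbours lie on the arc.\<close>

lemma cyc_adj_from_Suc:
  assumes "n \<ge> 3 * q + 1" "q \<ge> 2" "k < n"
  shows "geometric_realization (nonclique_complex {..<n} (cyc_adj_from n q (Suc k)))
           homotopy_equivalent_space
         geometric_realization (nonclique_complex {..<n} (cyc_adj_from n q k))"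
proof -
  have n0: "0 < n" using assms by simp
  obtain b where b: "b < n" "cyc_dist n k b = int q" using ex_cyc_dist[of q n k] assms by auto
  obtain w where w: "w < n" "cyc_dist n k w = int 1" using ex_cyc_dist[of 1 n k] assms by auto
  \<comment> \<open>The vertex just beyond the arc shows that \<open>?S\<close> is not all of
    \<open>{..<n}\<close>.\<close>
  obtain z where z: "z < n" "cyc_dist n k z = int (q + 1)" using ex_cyc_dist[of "q + 1" n k] assms by auto
  let ?S = "{c \<in> {..<n}. cyc_dist n k c \<le> int q}"
  have kk: "cyc_dist n k k = 0" by (simp add: cyc_dist_def)
  note rel = cyc_dist_relative[OF n0, of _ _ k]
  have q1: "int (q - 1) = int q - 1" and nq: "int n \<ge> 3 * int q + 1" "int q \<ge> 2"
    using assms by auto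
  have "cyc_adj_from n q (Suc k) u v \<longleftrightarrow> cyc_adj_from n q k u v \<and> {u, v} \<noteq> {k, b}"
    if "u < n" "v < n" for u v
  proof -
    have b_iff: "x = b \<longleftrightarrow> cyc_dist n k x = int q" if "x < n" for x
      using cyc_dist_eq_iff[OF that b(1), of k] b(2) by simp
    have k_iff: "x = k \<longleftrightarrow> cyc_dist n k x = 0" if "x < n" for x
      using cyc_dist_eq_iff[OF that assms(3), of k] kk by simp
    have r: "0 \<le> cyc_dist n k u" "cyc_dist n k u < int n" "0 \<le> cyc_dist n k v" "cyc_dist n k v < int n"
      using cyc_dist_range[OF n0] by auto
    have le: "Suc k \<le> x \<longleftrightarrow> k \<le> x \<and> x \<noteq> k" for x by auto
    show ?thesis
      unfolding cyc_adj_from_def cyc_adj_def le doubleton_eq_iff q1 atLeastAtMost_iff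
      unfolding b_iff[OF that(1)] b_iff[OF that(2)] k_iff[OF that(1)] k_iff[OF that(2)]
      using rel[of u v] rel[of v u] r nq by (smt (verit))
  qed
  then have "nonclique_complex {..<n} (cyc_adj_from n q (Suc k)) =
      nonclique_complex {..<n} (\<lambda>u v. cyc_adj_from n q k u v \<and> {u, v} \<noteq> {k, b})"
    unfolding nonclique_complex_def by auto
  moreover have "geometric_realization (nonclique_complex {..<n} (\<lambda>u v. cyc_adj_from n q k u v \<and> {u, v} \<noteq> {k, b}))
     homotopy_equivalent_space
         geometric_realization (nonclique_complex {..<n} (cyc_adj_from n q k))"
  proof (rule nonclique_complex_delete_edge[where w = w and S = ?S])
    show "k \<noteq> b" "w \<noteq> k" "w \<noteq> b" using kk b w assms by auto
    have "z \<notin> ?S" using z(2) by simp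
    then show "?S \<subset> {..<n}" using z(1) by blast
    show "cyc_adj_from n q k u v" if "u \<in> ?S" "v \<in> ?S" "u \<noteq> v" for u v
    proof -
      have uv: "u < n" "v < n" "cyc_dist n k u \<le> int q" "cyc_dist n k v \<le> int q"
        "cyc_dist n k u \<noteq> cyc_dist n k v"
        using that cyc_dist_eq_iff[of u n v k] by auto
      have k_iff: "x = k \<longleftrightarrow> cyc_dist n k x = 0" if "x < n" for x
        using cyc_dist_eq_iff[OF that assms(3), of k] kk by simp
      have r: "0 \<le> cyc_dist n k u" "0 \<le> cyc_dist n k v"
        using cyc_dist_range[OF n0] by auto
      \<comment> \<open>The only pair at distance \<open>q\<close> within the arc is
        \<open>{k, b}\<close>, and its edge is still present at stage \<open>k\<close>; all other
        pairs are closer.\<close>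
      have "(cyc_dist n k u = 0 \<longrightarrow> k \<le> u) \<and> (cyc_dist n k v = 0 \<longrightarrow> k \<le> v)" using k_iff uv by auto
      then show ?thesis
        unfolding cyc_adj_from_def cyc_adj_def q1 atLeastAtMost_iff
        using rel[of u v] rel[of v u] r uv(3-5) nq by (smt (verit))
    qed
    show "c \<in> ?S" if "c \<in> {..<n}" "cyc_adj_from n q k k c" "cyc_adj_from n q k b c" for c
    proof -
      have r: "0 \<le> cyc_dist n k c" "cyc_dist n k c < int n" using cyc_dist_range[OF n0] by auto
      have "cyc_dist n k c \<le> int q"
        using that(2,3) r nq b(2) kk rel[of c k] rel[of b c] rel[of c b]
        unfolding cyc_adj_from_def cyc_adj_def q1 atLeastAtMost_iff by (smt (verit))
      then show ?thesis using that(1) by simp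
    qed
    show "w \<in> ?S" "k \<in> ?S" "b \<in> ?S" using b w kk assms by auto
  qed (use assms(3) b(1) cyc_adj_from_sym in auto)
  ultimately show ?thesis by simp
qed

lemma cyc_adj_from_0:
  assumes "q \<ge> 1"
  shows "cyc_adj_from n q 0 = cyc_adj n q"
proof -
  have *: "x \<in> {1..int q} \<longleftrightarrow> x \<in> {1..int (q - 1)} \<or> x = int q" for x using assms by auto
  show ?thesis unfolding cyc_adj_from_def cyc_adj_def fun_eq_iff * by auto
qed

text \<open>Lowering the power by one removes the \<open>n\<close> longest edges one at a time. The
  bound on \<open>n\<close> only weakens as \<open>q\<close> decreases, so every stage satisfies
  it.\<close>

lemma nonclique_complex_cyc_adj_lower:
  assumes "n \<ge> 3 * q + 1" "q \<ge> 1"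
  shows "geometric_realization (nonclique_complex {..<n} (cyc_adj n q))
           homotopy_equivalent_space
         geometric_realization (nonclique_complex {..<n} (cyc_adj n 1))"
  using assms(2,1)
proof (induction q rule: nat_induct_at_least)
  case base
  show ?case by (rule homotopy_equivalent_space_refl)
next
  case (Suc q)
  have n: "3 * Suc q + 1 \<le> n" and q: "1 \<le> q" using Suc by auto
  let ?X = "\<lambda>k. geometric_realization (nonclique_complex {..<n} (cyc_adj_from n (Suc q) k))"
  have "?X 0 homotopy_equivalent_space ?X k" if "k \<le> n" for k
    using that
  proof (induction k)
    case (Suc k)
    then have "?X 0 homotopy_equivalent_space ?X k" using Suc_leD by blast
    also have "?X k homotopy_equivalent_space ?X (Suc k)"
      by (rule homotopy_equivalent_space_sym[THEN iffD1, OF cyc_adj_from_Suc]) (use Suc.prems q n in auto)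
    finally show ?case .
  qed (rule homotopy_equivalent_space_refl)
  moreover have "nonclique_complex {..<n} (cyc_adj_from n (Suc q) n) = nonclique_complex {..<n} (cyc_adj n q)"
  proof -
    have "cyc_adj_from n (Suc q) n u v \<longleftrightarrow> cyc_adj n q u v" if "u < n" "v < n" for u v
      using that by (simp add: cyc_adj_from_def)
    then show ?thesis unfolding nonclique_complex_def by auto
  qed
  ultimately have "geometric_realization (nonclique_complex {..<n} (cyc_adj n (Suc q)))
     homotopy_equivalent_space geometric_realization (nonclique_complex {..<n} (cyc_adj n q))"
    using cyc_adj_from_0[of "Suc q" n] by (metis le_add1 le_refl plus_1_eq_Suc)
  also have "\<dots> homotopy_equivalent_space geometric_realization (nonclique_complex {..<n} (cyc_adj n 1))"
    using Suc.IH n by simp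
  finally show ?case .
qed

section \<open>The cycle itself\<close>

lemma cyc_adj_1:
  assumes "u < n" "v < n" "n \<ge> 3"
  shows "cyc_adj n 1 u v \<longleftrightarrow> v = Suc u \<or> u = Suc v \<or> (u = 0 \<and> v = n - 1) \<or> (v = 0 \<and> u = n - 1)"
proof -
  have d: "cyc_dist n x y = 1 \<longleftrightarrow> y = Suc x \<or> (y = 0 \<and> x = n - 1)" if "x < n" "y < n" for x y
  proof -
    have "cyc_dist n 0 z = int z" if "z < n" for z using that by (simp add: cyc_dist_def)
    then show ?thesis using cyc_dist_relative[of n x y 0] that assms by auto
  qed
  show ?thesis unfolding cyc_adj_def using d[OF assms(1,2)] d[OF assms(2,1)] by auto
qed

lemma nonclique_complex_cycle:
  assumes n: "n \<ge> 4"
  shows "geometric_realization (nonclique_complex {..<n} (cyc_adj n 1))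
           homotopy_equivalent_space nsphere (n - 4)"
proof -
  define E where "E = cyc_adj n 1"
  define D where "D = nonclique_complex {..<n} E"
  have E: "E u v \<longleftrightarrow> v = Suc u \<or> u = Suc v \<or> (u = 0 \<and> v = n - 1) \<or> (v = 0 \<and> u = n - 1)"
    if "u < n" "v < n" for u v
    using cyc_adj_1[OF that] n by (simp add: E_def)
  have DI: "\<sigma> \<in> D" if "\<sigma> \<subseteq> {..<n}" "u < n" "v < n" "u \<notin> \<sigma>" "v \<notin> \<sigma>" "u \<noteq> v" "\<not> E u v" for \<sigma> u v
    using that unfolding D_def nonclique_complex_def by blast
  have DE: "\<exists>u<n. \<exists>v<n. u \<notin> \<sigma> \<and> v \<notin> \<sigma> \<and> u \<noteq> v \<and> \<not> E u v" "\<sigma> \<subseteq> {..<n}" if "\<sigma> \<in> D" for \<sigma>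
    using that unfolding D_def nonclique_complex_def by blast+
  have fin: "finite \<sigma>" if "\<sigma> \<in> D" for \<sigma> using DE(2)[OF that] finite_subset by blast
  have down: "\<tau> \<in> D" if "\<sigma> \<in> D" "\<tau> \<subseteq> \<sigma>" for \<sigma> \<tau>
    using that unfolding D_def nonclique_complex_def by blast
  \<comment> \<open>The intervals shrink as \<open>m\<close> grows, so avoiding the current one
    implies avoiding all earlier ones. Passing from \<open>K m\<close> to \<open>K (Suc m)\<close>
    deletes the star of \<open>{m + 2..n - 2}\<close>, hence the apex \<open>m\<close>.\<close>
  define K where "K m = {\<sigma> \<in> D. \<not> {Suc m..n - 2} \<subseteq> \<sigma>}" for m
  \<comment> \<open>The complement of a face contains a non-edge, so it cannot lie inside an edge
    \<open>{x, y}\<close>.\<close>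
  have third: "\<exists>c<n. c \<notin> \<sigma> \<and> c \<noteq> x \<and> c \<noteq> y" if s: "\<sigma> \<in> D" "E x y" "x < n" "y < n" for \<sigma> x y
  proof -
    obtain u v where uv: "u < n" "v < n" "u \<notin> \<sigma>" "v \<notin> \<sigma>" "u \<noteq> v" "\<not> E u v" using DE(1)[OF s(1)] by blast
    have "E y x" using s E by auto
    then show ?thesis using uv s by metis
  qed
  have step: "geometric_realization (K m) homotopy_equivalent_space geometric_realization (K (Suc m))"
    if m: "Suc m \<le> n - 3" for m
  proof -
    have "geometric_realization (K m) homotopy_equivalent_space
          geometric_realization {\<sigma> \<in> K m. \<not> {Suc (Suc m)..n - 2} \<subseteq> \<sigma>}"
    proof (rule homotopy_equivalent_space_delete_cone_star[where w = m])
      show "insert m \<sigma> \<in> K m" if s: "\<sigma> \<in> K m" "{Suc (Suc m)..n - 2} \<subseteq> \<sigma>" for \<sigma>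
      proof -
        have sD: "\<sigma> \<in> D" and m1: "Suc m \<notin> \<sigma>"
          using s by (auto simp: K_def subset_iff) (metis Suc_leI le_neq_implies_less)
        have "E m (Suc m)" using E[of m "Suc m"] m n by auto
        moreover have "Suc m < n" using m n by linarith
        ultimately obtain c where c: "c < n" "c \<notin> \<sigma>" "c \<noteq> m" "c \<noteq> Suc m"
          using third[OF sD, of m "Suc m"] Suc_lessD by blast
        have "c < m \<or> c = n - 1"
        proof (rule ccontr)
          assume "\<not> (c < m \<or> c = n - 1)"
          then have "c \<in> {Suc (Suc m)..n - 2}" using c by auto
          then show False using s(2) c(2) by blast
        qed
        \<comment> \<open>Both cases keep \<open>c\<close> away from the neighbours \<open>m\<close>
          and \<open>m + 2\<close> of \<open>m + 1\<close>; for \<open>c = n - 1\<close> this uses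
          \<open>m + 1 \<le> n - 3\<close>. So \<open>{c, m + 1}\<close> witnesses that
          \<open>m\<close> may be inserted.\<close>
        then have "\<not> E c (Suc m)" using E[of c "Suc m"] c m n by auto
        then have "insert m \<sigma> \<in> D"
          using c m1 m n DE(2)[OF sD] by (intro DI[of _ c "Suc m"]) auto
        moreover have "\<not> {Suc m..n - 2} \<subseteq> insert m \<sigma>"
        proof
          assume "{Suc m..n - 2} \<subseteq> insert m \<sigma>"
          moreover have "Suc m \<in> {Suc m..n - 2}" using m n by simp
          ultimately have "Suc m \<in> insert m \<sigma>" by (rule subsetD)
          then show False using m1 by simp
        qed
        ultimately show ?thesis unfolding K_def by simp
      qed
      show "finite \<sigma>" if "\<sigma> \<in> K m" for \<sigma> using that fin[of \<sigma>] unfolding K_def by blast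
      show "\<tau> \<in> K m" if "\<sigma> \<in> K m" "\<tau> \<subseteq> \<sigma>" for \<sigma> \<tau>
      proof -
        have "\<tau> \<in> D" using that down[of \<sigma> \<tau>] unfolding K_def by simp
        then show ?thesis using that unfolding K_def by blast
      qed
      have "Suc (Suc m) \<le> n - 2" using m n by linarith
      then show "{Suc (Suc m)..n - 2} \<noteq> {}" by simp
    qed simp_all
    moreover have "{Suc (Suc m)..n - 2} \<subseteq> {Suc m..n - 2}" by simp
    then have "{\<sigma> \<in> K m. \<not> {Suc (Suc m)..n - 2} \<subseteq> \<sigma>} = K (Suc m)"
      unfolding K_def by (auto dest: subset_trans simp del: atLeastatMost_subset_iff)
    ultimately show ?thesis by simp
  qed
  have "geometric_realization (K 0) homotopy_equivalent_space geometric_realization (K m)"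
    if "m \<le> n - 3" for m
    using that
  proof (induction m)
    case (Suc m)
    then show ?case using step[of m] homotopy_eqv_trans by fastforce
  qed (rule homotopy_equivalent_space_refl)
  then have "geometric_realization (K 0) homotopy_equivalent_space geometric_realization (K (n - 3))"
    by simp
  moreover have "K 0 = D"
  proof -
    \<comment> \<open>The complement would lie inside the edge \<open>{0, n - 1}\<close>.\<close>
    have "\<not> {Suc 0..n - 2} \<subseteq> \<sigma>" if s: "\<sigma> \<in> D" for \<sigma>
    proof -
      have "E 0 (n - 1)" using E[of 0 "n - 1"] n by auto
      then obtain c where c: "c < n" "c \<notin> \<sigma>" "c \<noteq> 0" "c \<noteq> n - 1"
        using third[OF s, of 0 "n - 1"] n by auto
      then have "c \<in> {Suc 0..n - 2}" by auto
      then show ?thesis using c by blast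
    qed
    then show ?thesis by (auto simp: K_def)
  qed
  moreover have "K (n - 3) = {\<sigma> \<in> D. n - 2 \<notin> \<sigma>}"
  proof -
    have "{Suc (n - 3)..n - 2} = {n - 2}" using n by auto
    then show ?thesis by (simp add: K_def)
  qed
  moreover have "geometric_realization {\<sigma> \<in> D. n - 2 \<notin> \<sigma>} homotopy_equivalent_space
      geometric_realization {\<sigma> \<in> {\<sigma> \<in> D. n - 2 \<notin> \<sigma>}. \<not> {n - 1} \<subseteq> \<sigma>}"
  proof (rule homotopy_equivalent_space_delete_cone_star[where w = "n - 3"])
    show "insert (n - 3) \<sigma> \<in> {\<sigma> \<in> D. n - 2 \<notin> \<sigma>}"
      if s: "\<sigma> \<in> {\<sigma> \<in> D. n - 2 \<notin> \<sigma>}" "{n - 1} \<subseteq> \<sigma>" for \<sigma>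
    proof -
      have "E (n - 3) (n - 2)" using E[of "n - 3" "n - 2"] n by auto
      then obtain c where c: "c < n" "c \<notin> \<sigma>" "c \<noteq> n - 3" "c \<noteq> n - 2"
        using third[of \<sigma> "n - 3" "n - 2"] s n by auto
      \<comment> \<open>The neighbours of \<open>n - 2\<close> are \<open>n - 3\<close> and
        \<open>n - 1\<close>, both now excluded, so \<open>{c, n - 2}\<close> remains a witness once
        \<open>n - 3\<close> is inserted.\<close>
      have "c \<noteq> n - 1" using c s by auto
      then have "\<not> E c (n - 2)" using E[of c "n - 2"] c n by auto
      then have "insert (n - 3) \<sigma> \<in> D"
        using c s n DE(2)[of \<sigma>] by (intro DI[of _ c "n - 2"]) auto
      then show ?thesis using s n by auto
    qed
    show "finite \<sigma>" if "\<sigma> \<in> {\<sigma> \<in> D. n - 2 \<notin> \<sigma>}" for \<sigma> using that fin[of \<sigma>] by blast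
    show "\<tau> \<in> {\<sigma> \<in> D. n - 2 \<notin> \<sigma>}" if "\<sigma> \<in> {\<sigma> \<in> D. n - 2 \<notin> \<sigma>}" "\<tau> \<subseteq> \<sigma>" for \<sigma> \<tau>
      using that down[of \<sigma> \<tau>] by auto
  qed (use n in auto)
  moreover have "{\<sigma> \<in> {\<sigma> \<in> D. n - 2 \<notin> \<sigma>}. \<not> {n - 1} \<subseteq> \<sigma>} = {\<sigma>. \<sigma> \<subset> {..Suc (n - 4)}}"
  proof (intro equalityI subsetI)
    fix \<sigma> assume s: "\<sigma> \<in> {\<sigma> \<in> {\<sigma> \<in> D. n - 2 \<notin> \<sigma>}. \<not> {n - 1} \<subseteq> \<sigma>}"
    have "E (n - 2) (n - 1)" using E[of "n - 2" "n - 1"] n by auto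
    then obtain c where c: "c < n" "c \<notin> \<sigma>" "c \<noteq> n - 2" "c \<noteq> n - 1"
      using third[of \<sigma> "n - 2" "n - 1"] s n by auto
    have "x \<le> Suc (n - 4)" if "x \<in> \<sigma>" for x
    proof -
      have "x < n" "x \<noteq> n - 2" "x \<noteq> n - 1" using s that DE(2)[of \<sigma>] by auto
      then show ?thesis by auto
    qed
    moreover have "c \<le> Suc (n - 4)" using c by auto
    ultimately show "\<sigma> \<in> {\<sigma>. \<sigma> \<subset> {..Suc (n - 4)}}" using c by auto
  next
    fix \<sigma> assume "\<sigma> \<in> {\<sigma>. \<sigma> \<subset> {..Suc (n - 4)}}"
    then obtain c where c: "c \<le> Suc (n - 4)" "c \<notin> \<sigma>" and s: "\<sigma> \<subseteq> {..Suc (n - 4)}" by auto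
    have ns: "n - 2 \<notin> \<sigma>" "n - 1 \<notin> \<sigma>" using s n by auto
    have cn: "c < n - 2" using c n by auto
    \<comment> \<open>A vertex below \<open>n - 2\<close> adjacent to both would be
      \<open>n - 3\<close> and \<open>0\<close> at once, which \<open>n \<ge> 4\<close> rules
      out.\<close>
    have "\<not> E c (n - 2) \<or> \<not> E c (n - 1)" using E[of c "n - 2"] E[of c "n - 1"] cn n by auto
    moreover have "\<sigma> \<subseteq> {..<n}" using s n by auto
    ultimately have "\<sigma> \<in> D" using DI[of \<sigma> c "n - 2"] DI[of \<sigma> c "n - 1"] c cn ns by auto
    then show "\<sigma> \<in> {\<sigma> \<in> {\<sigma> \<in> D. n - 2 \<notin> \<sigma>}. \<not> {n - 1} \<subseteq> \<sigma>}" using ns by auto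
  qed
  moreover have "geometric_realization {\<sigma>. \<sigma> \<subset> {..Suc (n - 4)}} homotopy_equivalent_space nsphere (n - 4)"
    by (intro homeomorphic_imp_homotopy_equivalent_space boundary_simplex_homeomorphic_nsphere)
  ultimately show ?thesis
    unfolding D_def E_def by (metis (no_types, lifting) homotopy_eqv_trans)
qed

section \<open>The case of antipodal non-edges\<close>

text \<open>The non-edges form a perfect matching, so the clique complex is the boundary of a
  cross-polytope, a sphere of dimension \<open>p\<close> on \<open>2 * p + 2\<close> vertices. This
  explains the dimension of the dual: \<open>(2 * p + 2) - p - 3 = p - 1\<close>.\<close>

lemma nonclique_complex_cross_polytope:
  assumes p: "p \<ge> 1" and E: "\<And>u v. u < 2 * p + 2 \<Longrightarrow> v < 2 * p + 2 \<Longrightarrow> u \<noteq> v \<Longrightarrow>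
     \<not> E u v \<longleftrightarrow> v = u + Suc p \<or> u = v + Suc p"
  shows "geometric_realization (nonclique_complex {..<2 * p + 2} E)
           homotopy_equivalent_space nsphere (p - 1)"
proof -
  define D where "D = {\<sigma>. \<sigma> \<subseteq> {..<2 * p + 2} \<and> (\<exists>i\<le>p. i \<notin> \<sigma> \<and> i + Suc p \<notin> \<sigma>)}"
  have D: "nonclique_complex {..<2 * p + 2} E = D"
  proof (intro equalityI subsetI)
    fix \<sigma> assume "\<sigma> \<in> nonclique_complex {..<2 * p + 2} E"
    then obtain u v where *: "\<sigma> \<subseteq> {..<2 * p + 2}" "u < 2 * p + 2" "v < 2 * p + 2" "u \<notin> \<sigma>" "v \<notin> \<sigma>" "u \<noteq> v" "\<not> E u v"
      unfolding nonclique_complex_def by blast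
    then have "v = u + Suc p \<or> u = v + Suc p" using E by blast
    then show "\<sigma> \<in> D"
    proof
      assume "v = u + Suc p"
      then show ?thesis unfolding D_def using * by (auto intro!: exI[of _ u])
    next
      assume "u = v + Suc p"
      then show ?thesis unfolding D_def using * by (auto intro!: exI[of _ v])
    qed
  next
    fix \<sigma> assume "\<sigma> \<in> D"
    then obtain i where i: "\<sigma> \<subseteq> {..<2 * p + 2}" "i \<le> p" "i \<notin> \<sigma>" "i + Suc p \<notin> \<sigma>" unfolding D_def by blast
    then have "\<not> E i (i + Suc p)" using E[of i "i + Suc p"] by auto
    then show "\<sigma> \<in> nonclique_complex {..<2 * p + 2} E"
      using i unfolding nonclique_complex_def
      by (intro CollectI conjI bexI[of _ i] bexI[of _ "i + Suc p"]) auto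
  qed
  define K where "K m = {\<sigma> \<in> D. \<forall>i<m. i + Suc p \<notin> \<sigma>}" for m
  have step: "geometric_realization (K m) homotopy_equivalent_space geometric_realization (K (Suc m))"
    if m: "m \<le> p" for m
  proof -
    have "geometric_realization (K m) homotopy_equivalent_space
          geometric_realization {\<sigma> \<in> K m. \<not> {m + Suc p} \<subseteq> \<sigma>}"
    proof (rule homotopy_equivalent_space_delete_cone_star[where w = m])
      show "finite \<sigma>" if "\<sigma> \<in> K m" for \<sigma>
        using that by (auto simp: K_def D_def intro: finite_subset)
      show "\<tau> \<in> K m" if "\<sigma> \<in> K m" "\<tau> \<subseteq> \<sigma>" for \<sigma> \<tau>
        using that unfolding K_def D_def by blast
      show "insert m \<sigma> \<in> K m" if s: "\<sigma> \<in> K m" "{m + Suc p} \<subseteq> \<sigma>" for \<sigma>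
      proof -
        obtain i where i: "i \<le> p" "i \<notin> \<sigma>" "i + Suc p \<notin> \<sigma>" using s by (auto simp: K_def D_def)
        \<comment> \<open>The antipode of \<open>m\<close> lies in the face, so the pair that the
          face misses is another one and survives the insertion of \<open>m\<close>.\<close>
        moreover have "i \<noteq> m" using i s by auto
        ultimately show ?thesis using s m unfolding K_def D_def by (auto intro!: exI[of _ i])
      qed
    qed auto
    moreover have "{\<sigma> \<in> K m. \<not> {m + Suc p} \<subseteq> \<sigma>} = K (Suc m)"
      by (auto simp: K_def less_Suc_eq)
    ultimately show ?thesis by simp
  qed
  have "geometric_realization (K 0) homotopy_equivalent_space geometric_realization (K m)"
    if "m \<le> Suc p" for m
    using that
  proof (induction m)
    case (Suc m)
    then show ?case using step[of m] homotopy_eqv_trans by fastforce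
  qed (rule homotopy_equivalent_space_refl)
  then have "geometric_realization (K 0) homotopy_equivalent_space geometric_realization (K (Suc p))"
    by simp
  moreover have "K 0 = D" by (simp add: K_def)
  moreover have "K (Suc p) = {\<sigma>. \<sigma> \<subset> {..Suc (p - 1)}}"
  proof (intro equalityI subsetI)
    fix \<sigma> assume s: "\<sigma> \<in> K (Suc p)"
    have "x \<le> p" if "x \<in> \<sigma>" for x
    proof (rule ccontr)
      assume "\<not> x \<le> p"
      moreover have "x < 2 * p + 2" using s that by (auto simp: K_def D_def)
      ultimately have "x - Suc p < Suc p" "x - Suc p + Suc p = x" by auto
      then show False using s that unfolding K_def by (metis (mono_tags, lifting) mem_Collect_eq)
    qed
    moreover obtain i where "i \<le> p" "i \<notin> \<sigma>" using s by (auto simp: K_def D_def)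
    ultimately show "\<sigma> \<in> {\<sigma>. \<sigma> \<subset> {..Suc (p - 1)}}" using p by auto
  next
    fix \<sigma> assume "\<sigma> \<in> {\<sigma>. \<sigma> \<subset> {..Suc (p - 1)}}"
    then have "\<sigma> \<subset> {..p}" using p by simp
    then obtain i where "i \<le> p" "i \<notin> \<sigma>" "\<sigma> \<subseteq> {..p}" by auto
    then show "\<sigma> \<in> K (Suc p)" unfolding K_def D_def by (auto intro!: exI[of _ i])
  qed
  moreover have "geometric_realization {\<sigma>. \<sigma> \<subset> {..Suc (p - 1)}} homotopy_equivalent_space nsphere (p - 1)"
    by (intro homeomorphic_imp_homotopy_equivalent_space boundary_simplex_homeomorphic_nsphere)
  ultimately show ?thesis
    unfolding D by (metis homotopy_eqv_trans)
qed

section \<open>Translation from the graph and conclusion\<close>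

lemma parcs_cycle_power_iff:
  assumes "p < n" "u < n" "v < n"
  shows "(u, v) \<in> parcs (cycle_power n p) \<longleftrightarrow> cyc_adj n p u v"
proof -
  have d: "(\<exists>t\<in>{1..p}. [int y = int x + int t] (mod int n)) \<longleftrightarrow> cyc_dist n x y \<in> {1..int p}" for x y
  proof -
    have "[int y = int x + int t] (mod int n) \<longleftrightarrow> cyc_dist n x y = int t" if "t \<in> {1..p}" for t
    proof -
      have "[int y = int x + int t] (mod int n) \<longleftrightarrow> [int y - int x = int t] (mod int n)"
        by (simp add: cong_iff_dvd_diff algebra_simps)
      \<comment> \<open>Since \<open>t \<le> p < n\<close>, the number \<open>t\<close> is its own
        residue.\<close>
      also have "\<dots> \<longleftrightarrow> cyc_dist n x y = int t"
        using that assms by (auto simp: cong_def cyc_dist_def)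
      finally show ?thesis .
    qed
    then have "(\<exists>t\<in>{1..p}. [int y = int x + int t] (mod int n)) \<longleftrightarrow> (\<exists>t\<in>{1..p}. cyc_dist n x y = int t)"
      by blast
    also have "\<dots> \<longleftrightarrow> cyc_dist n x y \<in> {1..int p}"
      by (auto intro!: bexI[of _ "nat (cyc_dist n x y)"])
    finally show ?thesis .
  qed
  have sw: "[int v = int u - int t] (mod int n) \<longleftrightarrow> [int u = int v + int t] (mod int n)" for t
    unfolding cong_iff_dvd_diff by (metis dvd_minus_iff add.commute diff_diff_eq2 minus_diff_eq)
  have "u \<noteq> v" if "cyc_adj n p u v" using that by (auto simp: cyc_adj_def cyc_dist_def)
  then show ?thesis
    using assms d[of u v] d[of v u] unfolding cycle_power_def cyc_adj_def
    by (simp add: sw bex_disj_distrib) blast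
qed

lemma total_2_cut_complex_cycle_power:
  assumes "p < n"
  shows "total_2_cut_complex (cycle_power n p) = nonclique_complex {..<n} (cyc_adj n p)"
proof -
  interpret pair_graph "cycle_power n p" by (rule pair_graph_cycle_power)
  have V: "pverts (cycle_power n p) = {..<n}" by (auto simp: cycle_power_def)
  show ?thesis
    unfolding set_eq_iff total_2_cut_complex_iff V nonclique_complex_def
    using parcs_cycle_power_iff[OF assms] by fastforce
qed

text \<open>The two distances between distinct vertices add up to \<open>2 * p + 2\<close>, so both
  exceed \<open>p\<close> only if both equal \<open>p + 1\<close>.\<close>

lemma cyc_adj_cocktail_party:
  assumes "u < 2 * p + 2" "v < 2 * p + 2" "u \<noteq> v"
  shows "\<not> cyc_adj (2 * p + 2) p u v \<longleftrightarrow> v = u + Suc p \<or> u = v + Suc p"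
proof -
  have "cyc_dist (2 * p + 2) 0 z = int z" if "z < 2 * p + 2" for z
    using that by (simp add: cyc_dist_def)
  then show ?thesis
    unfolding cyc_adj_def using cyc_dist_relative[of "2 * p + 2" u v 0] cyc_dist_relative[of "2 * p + 2" v u 0] assms
    by (auto split: if_splits)
qed

theorem theorem3p10:
  fixes n p :: nat
  assumes "p \<ge> 1" and "n \<ge> 2 * p + 2"
  shows "(n = 2 * p + 2 \<longrightarrow>
            geometric_realization (total_2_cut_complex (cycle_power n p))
              homotopy_equivalent_space nsphere ((n - 4) div 2)) \<and>
         (n \<ge> 3 * p + 1 \<longrightarrow>
            geometric_realization (total_2_cut_complex (cycle_power n p))
              homotopy_equivalent_space nsphere (n - 4))"
proof (intro conjI impI)
  have D: "total_2_cut_complex (cycle_power n p) = nonclique_complex {..<n} (cyc_adj n p)"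
    using assms by (intro total_2_cut_complex_cycle_power) simp
  show "geometric_realization (total_2_cut_complex (cycle_power n p))
          homotopy_equivalent_space nsphere ((n - 4) div 2)" if n: "n = 2 * p + 2"
  proof -
    have "(n - 4) div 2 = p - 1" using n by simp
    then show ?thesis
      unfolding D using nonclique_complex_cross_polytope[OF assms(1) cyc_adj_cocktail_party] n by simp
  qed
  show "geometric_realization (total_2_cut_complex (cycle_power n p))
          homotopy_equivalent_space nsphere (n - 4)" if "n \<ge> 3 * p + 1"
    unfolding D
    using homotopy_eqv_trans[OF nonclique_complex_cyc_adj_lower[OF that assms(1)]
        nonclique_complex_cycle] assms by auto
qed

end
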